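(* For every integer $n\ge 2$, $$\tau(n)=\left\lfloor\frac{n-1}{2}\right\rfloor+\tau\!\left(\left\lfloor\frac{n}{2}\right\rfloor\right),$$ and for every positive integer $n$, $$\tau(n)=\sum_{j\ge 1}\left\lfloor\frac{n-2^{j-1}}{2^j}\right\rfloor = n-1-\lfloor \log_2 n\rfloor.$$
   Context: Multi-pass stack sorting: in a pass, the entries of the current input are pushed one at a time, in order, onto a stack; whenever the top of the stack is the smallest value not yet output, it is popped to the output (repeatedly); entries are never popped otherwise. When all input entries have been pushed and no pop is possible, if the stack is nonempty the remaining entries are returned to the input in their original relative order and a new pass begins. The tier $t(\sigma)$ of a permutation $\sigma$ is one less than the minimum number of passes needed to output $1,\dots,n$. For a positive integer $n$, $\tau(n)$ denotes the maximum of $t(\sigma)$ over all permutations $\sigma$ of length $n$.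
   Formalization: The sum is taken only over j ≥ 1 with 2^(j−1) ≤ n, because for larger j every term ⌊(n − 2^(j−1))/2^j⌋ equals −1 and the series over all j ≥ 1 diverges. *)

theory Defs
  imports Complex_Main "HOL-Combinatorics.Multiset_Permutations"
begin

text \<open>
  A permutation of length \<open>n\<close> is the list of its entries, i.e. an element of
  \<^term>\<open>permutations_of_set {1..n}\<close>. Since entries leave the stack only in the order
  \<open>1, 2, 3, \<dots>\<close>, the output is recorded by the smallest value \<open>k\<close> not yet output: the
  output so far is \<open>1, \<dots>, k - 1\<close>. A stack is a list whose head is its top.
\<close>

fun pop_all :: "nat \<Rightarrow> nat list \<Rightarrow> nat \<times> nat list" where
  "pop_all k [] = (k, [])"
| "pop_all k (x # st) = (if x = k then pop_all (Suc k) st else (k, x # st))"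

fun run_pass :: "nat \<Rightarrow> nat list \<Rightarrow> nat list \<Rightarrow> nat \<times> nat list" where
  "run_pass k st [] = (k, st)"
| "run_pass k st (x # inp) = (case pop_all k (x # st) of (k', st') \<Rightarrow> run_pass k' st' inp)"

text \<open>
  Entries were pushed in input order, so the stack read from bottom to top lists the
  remaining entries in their original relative order; hence the \<^const>\<open>rev\<close>.
\<close>

definition one_pass :: "nat \<times> nat list \<Rightarrow> nat \<times> nat list" where
  "one_pass s = (case s of (k, inp) \<Rightarrow> case run_pass k [] inp of (k', st) \<Rightarrow> (k', rev st))"

definition passes :: "nat list \<Rightarrow> nat" where
  "passes \<sigma> = (LEAST p. fst ((one_pass ^^ p) (1, \<sigma>)) = Suc (length \<sigma>))"

text \<open>
  For nonempty permutations at least one pass is needed, so the subtraction on \<^typ>\<open>nat\<close>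
  is not truncated.
\<close>

definition tier :: "nat list \<Rightarrow> nat" where
  "tier \<sigma> = passes \<sigma> - 1"

definition tau :: "nat \<Rightarrow> nat" where
  "tau n = Max (tier ` permutations_of_set {1..n})"

text \<open>
  In the series \<open>\<Sum>j\<ge>1. \<lfloor>(n - 2^(j-1)) / 2^j\<rfloor>\<close> all terms with \<open>2^(j-1) > n\<close> would be
  \<open>-1\<close>, and the series would diverge. The sum is therefore taken over the \<open>j \<ge> 1\<close> with
  \<open>2^(j-1) \<le> n\<close>; equivalently, negative terms count as \<open>0\<close>.
\<close>

lemma floor_term_eq_minus_one:
  fixes n j :: nat
  assumes "1 \<le> j" "n < 2 ^ (j - 1)"
  shows "\<lfloor>(real n - 2 ^ (j - 1)) / 2 ^ j\<rfloor> = -1"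
proof -
  obtain i where j: "j = Suc i" using assms(1) by (cases j) auto
  have "real n < real (2 ^ i)" using assms(2) unfolding j of_nat_less_iff by simp
  then have "real n < 2 ^ i" by simp
  moreover have "- (2 ^ i) \<le> real n" by (rule order_trans[of _ 0]) simp_all
  ultimately show ?thesis by (simp add: j floor_eq_iff field_simps)
qed

end

theory Submission
  imports Defs "HOL-Library.Sublist"
begin

text \<open>
  A pass stops at a value \<open>k + 1\<close> exactly when \<open>k + 1\<close> precedes \<open>k\<close> in the permutation with some
  \<open>c > k + 1\<close> in between: at the moment \<open>k\<close> is popped, \<open>k + 1\<close> is buried below \<open>c\<close>. The tier is
  therefore the number of such separated \<open>k\<close>. Cut \<open>1, \<dots>, n\<close> after every \<open>k\<close> that is not
  separated. The \<open>s\<close> values of a block appear in decreasing order, with a larger value from a later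
  block in each of their \<open>s - 1\<close> gaps, so \<open>s\<close> is at most one more than the number of later values;
  hence \<open>g\<close> blocks cover at most \<open>2\<^sup>g - 1\<close> values. Conversely, interleaving \<open>s, \<dots>, 1\<close> with an
  optimal permutation of the remaining \<open>\<lfloor>n/2\<rfloor>\<close> larger values attains the bound.
\<close>

section \<open>Separation as a pattern of three positions\<close>

definition separated :: "nat list \<Rightarrow> nat \<Rightarrow> bool" where
  "separated xs k \<longleftrightarrow> (\<exists>c>Suc k. subseq [Suc k, c, k] xs)"

lemma subseq_Cons_iff_nth:
  "subseq (x # xs) ys \<longleftrightarrow> (\<exists>i<length ys. ys ! i = x \<and> subseq xs (drop (Suc i) ys))"
proof
  assume "subseq (x # xs) ys"
  then obtain us vs where "ys = us @ x # vs" "subseq xs vs"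
    by (auto dest: list_emb_ConsD)
  then show "\<exists>i<length ys. ys ! i = x \<and> subseq xs (drop (Suc i) ys)"
    by (intro exI[of _ "length us"]) simp
next
  assume "\<exists>i<length ys. ys ! i = x \<and> subseq xs (drop (Suc i) ys)"
  then obtain i where i: "i < length ys" "ys ! i = x" "subseq xs (drop (Suc i) ys)" by blast
  then have "ys = take i ys @ x # drop (Suc i) ys" using id_take_nth_drop by blast
  then show "subseq (x # xs) ys" using i(3) by (metis list_emb_append2 subseq_Cons2)
qed

text \<open>Positions let distinctness identify two occurrences of the same value, which comparing
  different patterns requires.\<close>

lemma subseq3_iff_nth:
  "subseq [a, b, c] xs \<longleftrightarrow>
    (\<exists>i j l. i < j \<and> j < l \<and> l < length xs \<and> xs ! i = a \<and> xs ! j = b \<and> xs ! l = c)"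
  (is "?L = ?R")
proof
  assume ?L
  then obtain i j l where "i < length xs" "xs ! i = a" "j < length xs - Suc i"
    "xs ! (Suc i + j) = b" "l < length xs - Suc i - Suc j" "xs ! (Suc i + (Suc j + l)) = c"
    unfolding subseq_Cons_iff_nth by (auto simp: ac_simps)
  then show ?R
    by (intro exI[of _ i] exI[of _ "Suc i + j"] exI[of _ "Suc i + (Suc j + l)"]) auto
next
  assume ?R
  then obtain i j l where ijl: "i < j" "j < l" "l < length xs" "xs ! i = a" "xs ! j = b" "xs ! l = c"
    by blast
  then show ?L
    unfolding subseq_Cons_iff_nth
    by (intro exI[of _ i] exI[of _ "j - Suc i"] exI[of _ "l - Suc j"] conjI) auto
qed

text \<open>A later pass sees only the entries from \<open>m\<close> on. The pattern for
  \<open>k\<close> consists of such entries, so it survives the filter.\<close>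

lemma separated_filter:
  assumes "m \<le> k"
  shows "separated (filter ((\<le>) m) xs) k \<longleftrightarrow> separated xs k"
proof
  assume "separated (filter ((\<le>) m) xs) k"
  then show "separated xs k"
    unfolding separated_def using subseq_filter_left subseq_order.trans by blast
next
  assume "separated xs k"
  then obtain c where c: "c > Suc k" "subseq [Suc k, c, k] xs" unfolding separated_def by blast
  have "subseq (filter ((\<le>) m) [Suc k, c, k]) (filter ((\<le>) m) xs)"
    using c(2) by (rule subseq_filter)
  then show "separated (filter ((\<le>) m) xs) k"
    unfolding separated_def using c(1) assms by auto
qed

section \<open>Popping and the invariant of a pass\<close>

text \<open>Locates the top of the stack in the list read so far, as the last entry satisfying
  \<open>P\<close>.\<close>

lemma filter_eq_snocD:
  assumes "filter P xs = us @ [x]"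
  obtains vs ws where "xs = vs @ x # ws" "filter P vs = us" "\<forall>w\<in>set ws. \<not> P w" "P x"
proof -
  have "filter P (rev xs) = x # rev us" using assms by (simp flip: rev_filter)
  then obtain as bs where ab: "rev xs = as @ x # bs" "\<forall>a\<in>set as. \<not> P a" "P x"
    "rev us = filter P bs"
    by (auto dest!: filter_eq_ConsD)
  show thesis
  proof (rule that[of "rev bs" "rev as"])
    show "xs = rev bs @ x # rev as" using arg_cong[OF ab(1), of rev] by simp
    show "filter P (rev bs) = us" using arg_cong[OF ab(4), of rev] by (simp add: rev_filter)
  qed (use ab in auto)
qed

text \<open>The stack holds the entries read but not yet output, newest on top. A value is popped
  only when everything to its right is already output, hence smaller; a value \<open>k'\<close> that
  was read but stays is buried below a larger entry.\<close>

lemma pop_all_rev_filter: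
  assumes "distinct xs" "pop_all k (rev (filter ((\<le>) k) xs)) = (k', st)"
  shows "k \<le> k' \<and> st = rev (filter ((\<le>) k') xs) \<and>
    (\<forall>j\<in>{k..<k'}. \<exists>i<length xs. xs ! i = j \<and> (\<forall>l<length xs. i < l \<longrightarrow> xs ! l \<le> j)) \<and>
    (k' \<in> set xs \<longrightarrow> (\<exists>i l. i < l \<and> l < length xs \<and> xs ! i = k' \<and> k' < xs ! l))"
  using assms(2)
proof (induction k "rev (filter ((\<le>) k) xs)" rule: pop_all.induct)
  case (1 k)
  from 1(1) have e: "filter ((\<le>) k) xs = []" by simp
  with 1 show ?case by (auto simp: filter_empty_conv)
next
  case (2 k x st0)
  have eq: "filter ((\<le>) k) xs = rev st0 @ [x]"
    using 2(2) by (metis rev.simps(2) rev_rev_ident)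
  then obtain vs ws where d: "xs = vs @ x # ws" "filter ((\<le>) k) vs = rev st0"
    "\<forall>w\<in>set ws. \<not> k \<le> w" "k \<le> x"
    by (rule filter_eq_snocD)
  show ?case
  proof (cases "x = k")
    case True
    \<comment> \<open>By distinctness \<open>k\<close> occurs only as \<open>x\<close>, so raising
      the threshold removes exactly the popped entry.\<close>
    have "filter ((\<le>) (Suc k)) vs = filter ((\<le>) k) vs"
      using d(1) assms(1) True by (intro filter_cong) (auto simp: Suc_le_eq nat_less_le)
    moreover have "filter ((\<le>) (Suc k)) ws = []"
      using d(3) by (auto simp: filter_empty_conv)
    ultimately have st: "st0 = rev (filter ((\<le>) (Suc k)) xs)"
      using d True by simp
    have "pop_all (Suc k) st0 = (k', st)" using 2(2,3) True by (metis pop_all.simps(2))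
    note IH = 2(1)[OF True st this[unfolded st]]
    have top: "\<exists>i<length xs. xs ! i = k \<and> (\<forall>l<length xs. i < l \<longrightarrow> xs ! l \<le> k)"
      using d True by (intro exI[of _ "length vs"]) (auto simp: nth_append nth_Cons' not_le less_imp_le)
    show ?thesis
    proof (intro conjI ballI)
      fix j assume "j \<in> {k..<k'}"
      then consider "j = k" | "j \<in> {Suc k..<k'}" by fastforce
      then show "\<exists>i<length xs. xs ! i = j \<and> (\<forall>l<length xs. i < l \<longrightarrow> xs ! l \<le> j)"
        by cases (use top IH in blast)+
    qed (use IH in auto)
  next
    case False
    then have r: "k' = k" "st = rev (filter ((\<le>) k) xs)"
      using 2(2,3) by (metis pop_all.simps(2) Pair_inject)+
    \<comment> \<open>The top \<open>x\<close>, at position \<open>length vs\<close>, exceeds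
      \<open>k\<close> and buries it.\<close>
    have "\<exists>i l. i < l \<and> l < length xs \<and> xs ! i = k \<and> k < xs ! l" if "k \<in> set xs"
    proof -
      have "k \<in> set vs" using that d False by auto
      then obtain i where "i < length vs" "vs ! i = k" by (auto simp: in_set_conv_nth)
      then show ?thesis using d False
        by (intro exI[of _ i] exI[of _ "length vs"]) (auto simp: nth_append)
    qed
    then show ?thesis using r by auto
  qed
qed

text \<open>
  Here \<open>zs\<close> is the input of a pass that starts with next output \<open>k0\<close>, \<open>xs\<close> is the part of \<open>zs\<close>
  read so far, and \<open>k\<close> is the current next output.
\<close>

definition pass_inv :: "nat \<Rightarrow> nat list \<Rightarrow> nat list \<Rightarrow> nat \<Rightarrow> bool" where
  "pass_inv k0 zs xs k \<longleftrightarrow> k0 \<le> k \<and> {k0..<k} \<subseteq> set xs \<and>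
    (k \<in> set xs \<longrightarrow> k0 < k \<and> separated zs (k - 1)) \<and>
    (\<forall>j. k0 \<le> j \<and> Suc j < k \<longrightarrow> \<not> separated zs j)"

text \<open>Reading an entry other than \<open>k\<close> allows no pop. Reading \<open>k\<close>
  starts a run of pops up to \<open>k' - 1\<close>, and only the point where the run stops can be a
  separation.\<close>

lemma pass_inv_step:
  assumes inv: "pass_inv k0 zs xs k"
    and zs: "zs = xs @ x # ys" "distinct zs" "\<forall>j\<in>set zs. k0 \<le> j"
    and pop: "pop_all k (x # rev (filter ((\<le>) k) xs)) = (k', st)"
  shows "pass_inv k0 zs (xs @ [x]) k' \<and> st = rev (filter ((\<le>) k') (xs @ [x]))"
proof -
  have inj: "zs ! i = zs ! j \<longleftrightarrow> i = j" if "i < length zs" "j < length zs" for i j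
    using zs(2) that by (rule nth_eq_iff_index_eq)
  \<comment> \<open>The values \<open>k0, ..., k - 1\<close> have all been read before.\<close>
  have kx: "k \<le> x"
  proof (rule ccontr)
    assume "\<not> k \<le> x"
    then have "x \<in> set xs" using inv zs(1,3) unfolding pass_inv_def by auto
    then show False using zs by auto
  qed
  show ?thesis
  proof (cases "x = k")
    case False
    then show ?thesis using inv pop kx unfolding pass_inv_def by auto
  next
    case True
    let ?p = "xs @ [x]"
    have "filter ((\<le>) (Suc k)) xs = filter ((\<le>) k) xs"
      using zs True by (intro filter_cong) (auto simp: Suc_le_eq nat_less_le)
    then have "pop_all (Suc k) (rev (filter ((\<le>) (Suc k)) ?p)) = (k', st)"
      using pop True by simp
    moreover have "distinct ?p" using zs by simp
    ultimately have P: "Suc k \<le> k'" "st = rev (filter ((\<le>) k') ?p)"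
      "\<And>j. Suc k \<le> j \<Longrightarrow> j < k' \<Longrightarrow>
        \<exists>i<length ?p. ?p ! i = j \<and> (\<forall>l<length ?p. i < l \<longrightarrow> ?p ! l \<le> j)"
      "k' \<in> set ?p \<Longrightarrow> \<exists>i l. i < l \<and> l < length ?p \<and> ?p ! i = k' \<and> k' < ?p ! l"
      using pop_all_rev_filter[of ?p "Suc k" k' st] by auto
    have pz: "?p ! i = zs ! i" if "i < length ?p" for i
      using that zs(1) by (auto simp: nth_append nth_Cons')
    have len: "length ?p \<le> length zs" using zs(1) by simp
    \<comment> \<open>\<open>k\<close> was read last, so nothing follows it in the prefix; the other
      popped values come from \<open>P(3)\<close>.\<close>
    have top: "\<exists>i<length ?p. zs ! i = j \<and> (\<forall>l<length ?p. i < l \<longrightarrow> zs ! l \<le> j)"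
      if "k \<le> j" "j < k'" for j
    proof (cases "j = k")
      case True
      then show ?thesis using \<open>x = k\<close> zs(1)
        by (intro exI[of _ "length xs"]) (auto simp: nth_append)
    next
      case False
      then show ?thesis using P(3)[of j] that pz by (metis Suc_leI le_neq_implies_less)
    qed
    have sub: "{k0..<k'} \<subseteq> set ?p"
    proof
      fix j assume j: "j \<in> {k0..<k'}"
      show "j \<in> set ?p"
      proof (cases "j < k")
        case True then show ?thesis using inv j unfolding pass_inv_def by auto
      next
        case False
        then obtain i where "i < length ?p" "zs ! i = j" using top[of j] j by auto
        then show ?thesis using pz by (metis nth_mem)
      qed
    qed
    \<comment> \<open>Nothing larger than \<open>k' - 1\<close> lies to its right in the prefix, so
      the entry burying \<open>k'\<close> stands between \<open>k'\<close> and
      \<open>k' - 1\<close>.\<close>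
    have "separated zs (k' - 1)" if k': "k' \<in> set ?p"
    proof -
      obtain i l where il: "i < l" "l < length ?p" "zs ! i = k'" "k' < zs ! l"
        using P(4)[OF k'] pz by (metis order.strict_trans)
      have k'1: "k \<le> k' - 1" "k' - 1 < k'" using P(1) by linarith+
      obtain m where m: "m < length ?p" "zs ! m = k' - 1"
        "\<forall>l<length ?p. m < l \<longrightarrow> zs ! l \<le> k' - 1"
        using top[OF k'1] by blast
      have "l \<noteq> m" using m(2) il(4) by auto
      moreover have "\<not> m < l" using m(3) il(2,4) by auto
      ultimately have "l < m" by simp
      then have "subseq [k', zs ! l, k' - 1] zs"
        unfolding subseq3_iff_nth using il m len by (intro exI[of _ i] exI[of _ l] exI[of _ m]) auto
      then show ?thesis unfolding separated_def using P(1) il(4) by auto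
    qed
    \<comment> \<open>The new case is \<open>k \<le> Suc j\<close>. When \<open>Suc j\<close> was
      popped, no larger entry of the prefix lay to its right; a separating entry would lie there,
      before the already read \<open>j\<close>.\<close>
    moreover have "\<not> separated zs j" if j: "k0 \<le> j" "Suc j < k'" for j
    proof (cases "Suc j < k")
      case True then show ?thesis using inv j unfolding pass_inv_def by auto
    next
      case False
      then obtain i where i: "i < length ?p" "zs ! i = Suc j"
        "\<forall>l<length ?p. i < l \<longrightarrow> zs ! l \<le> Suc j"
        using top[of "Suc j"] j by auto
      have "j \<in> set ?p" by (rule subsetD[OF sub]) (use j in simp)
      then obtain m where m: "m < length ?p" "zs ! m = j"
        using pz by (metis in_set_conv_nth)
      show ?thesis
      proof
        assume "separated zs j"
        then obtain a b c where abc: "a < b" "b < c" "c < length zs" "zs ! a = Suc j"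
          "Suc j < zs ! b" "zs ! c = j"
          unfolding separated_def subseq3_iff_nth by auto
        have "a = i" using abc i len inj[of a i] by auto
        moreover have cm: "c = m" using abc m len inj[of c m] by auto
        ultimately have "i < b" using abc(1) by simp
        moreover have "b < length ?p" using abc(2) m(1) unfolding cm by (rule less_trans)
        ultimately have "zs ! b \<le> Suc j" using i(3) by blast
        then show False using abc(5) by simp
      qed
    qed
    ultimately show ?thesis
      using inv P(1,2) sub unfolding pass_inv_def by simp
  qed
qed

lemma run_pass_inv:
  assumes "pass_inv k0 (xs @ ys) xs k" "distinct (xs @ ys)" "\<forall>j\<in>set (xs @ ys). k0 \<le> j"
  shows "\<exists>k'. run_pass k (rev (filter ((\<le>) k) xs)) ys = (k', rev (filter ((\<le>) k') (xs @ ys))) \<and>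
    pass_inv k0 (xs @ ys) (xs @ ys) k'"
  using assms
proof (induction ys arbitrary: xs k)
  case Nil
  then show ?case by auto
next
  case (Cons x ys)
  obtain k1 st where pop: "pop_all k (x # rev (filter ((\<le>) k) xs)) = (k1, st)" by fastforce
  have "pass_inv k0 (xs @ x # ys) (xs @ [x]) k1 \<and> st = rev (filter ((\<le>) k1) (xs @ [x]))"
    by (rule pass_inv_step[OF Cons.prems(1) refl _ _ pop]) (use Cons.prems in auto)
  then show ?case
    using Cons.IH[of "xs @ [x]" k1] Cons.prems pop by simp
qed

text \<open>The invariant at the end of the input. An unfinished pass uses up exactly one separated
  value, \<open>k' - 1\<close>; a finishing pass meets none.\<close>

lemma one_pass_filter:
  assumes "set xs = {1..n}" "distinct xs" "1 \<le> k" "k \<le> n"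
  obtains k' where "one_pass (k, filter ((\<le>) k) xs) = (k', filter ((\<le>) k') xs)"
    "k < k'" "k' \<le> Suc n" "k' \<le> n \<Longrightarrow> separated xs (k' - 1)"
    "\<And>j. k \<le> j \<Longrightarrow> Suc j < k' \<Longrightarrow> \<not> separated xs j"
proof -
  let ?zs = "filter ((\<le>) k) xs"
  have set: "set ?zs = {k..n}" using assms by auto
  have "pass_inv k ([] @ ?zs) [] k"
    unfolding pass_inv_def by (intro conjI allI impI) (simp_all, linarith)
  moreover have "distinct ([] @ ?zs)" "\<forall>j\<in>set ([] @ ?zs). k \<le> j" using assms(2) by auto
  ultimately obtain k' where
    r: "run_pass k [] ?zs = (k', rev (filter ((\<le>) k') ?zs))" and inv: "pass_inv k ?zs ?zs k'"
    using run_pass_inv[of k "[]" ?zs k] unfolding filter.simps rev.simps append_Nil by blast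
  have le: "k \<le> k'" and sub: "{k..<k'} \<subseteq> {k..n}"
    and sep: "k' \<in> {k..n} \<Longrightarrow> k < k' \<and> separated ?zs (k' - 1)"
    and nsep: "\<And>j. k \<le> j \<Longrightarrow> Suc j < k' \<Longrightarrow> \<not> separated ?zs j"
    using inv unfolding pass_inv_def set by blast+
  \<comment> \<open>\<open>k\<close> is in the input, so stopping at \<open>k\<close> would make the
    invariant claim \<open>k < k\<close>.\<close>
  have lt: "k < k'" using sep le assms(4) by (cases "k = k'") auto
  have "filter ((\<le>) k') ?zs = filter ((\<le>) k') xs"
    unfolding filter_filter using le by (intro filter_cong) auto
  with r have 1: "one_pass (k, ?zs) = (k', filter ((\<le>) k') xs)" by (simp add: one_pass_def)
  show thesis
  proof (rule that[OF 1 lt])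
    have "k' - 1 \<in> {k..<k'}" using lt by auto
    then show "k' \<le> Suc n" using sub by auto
    show "separated xs (k' - 1)" if "k' \<le> n"
      using sep that lt separated_filter[of k "k' - 1" xs] by fastforce
    show "\<not> separated xs j" if "k \<le> j" "Suc j < k'" for j
      using nsep[OF that] separated_filter[OF that(1)] by blast
  qed
qed

section \<open>The tier as a count of separated values\<close>

lemma funpow_one_pass_finished: "(one_pass ^^ p) (k, []) = (k, [])"
  by (induction p) (auto simp: one_pass_def)

text \<open>Each pass but the last uses up one separated value. An equivalence for every
  \<open>p\<close> lets the \<open>LEAST\<close> in \<open>passes\<close> be read off.\<close>

lemma sorted_iff_separated_less:
  assumes "set xs = {1..n}" "distinct xs" "1 \<le> k" "k \<le> n"
  shows "fst ((one_pass ^^ p) (k, filter ((\<le>) k) xs)) = Suc n \<longleftrightarrow>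
    card {j\<in>{k..<n}. separated xs j} < p"
  using assms(3,4)
proof (induction "n - k" arbitrary: k p rule: less_induct)
  case less
  show ?case
  proof (cases p)
    case 0
    then show ?thesis using less.prems by simp
  next
    case (Suc q)
    obtain k' where k': "one_pass (k, filter ((\<le>) k) xs) = (k', filter ((\<le>) k') xs)"
      "k < k'" "k' \<le> Suc n" "k' \<le> n \<Longrightarrow> separated xs (k' - 1)"
      "\<And>j. k \<le> j \<Longrightarrow> Suc j < k' \<Longrightarrow> \<not> separated xs j"
      using one_pass_filter[OF assms(1,2) less.prems] by metis
    have step: "(one_pass ^^ p) (k, filter ((\<le>) k) xs) = (one_pass ^^ q) (k', filter ((\<le>) k') xs)"
      unfolding Suc funpow_Suc_right using k'(1) by simp
    show ?thesis
    proof (cases "k' \<le> n")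
      case True
      have eq: "{j\<in>{k..<n}. separated xs j} = insert (k' - 1) {j\<in>{k'..<n}. separated xs j}"
      proof (intro equalityI subsetI)
        fix j assume j: "j \<in> {j\<in>{k..<n}. separated xs j}"
        then have "\<not> Suc j < k'" using k'(5)[of j] by auto
        then show "j \<in> insert (k' - 1) {j\<in>{k'..<n}. separated xs j}" using j by auto
      next
        fix j assume j: "j \<in> insert (k' - 1) {j\<in>{k'..<n}. separated xs j}"
        have "k' - 1 \<in> {k..<n}" using k'(2) True by (simp, linarith)
        then show "j \<in> {j\<in>{k..<n}. separated xs j}" using j k'(2) k'(4)[OF True] by auto
      qed
      have card: "card {j\<in>{k..<n}. separated xs j} = Suc (card {j\<in>{k'..<n}. separated xs j})"
        unfolding eq by (rule card_insert_disjoint) (use k'(2) in auto)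
      have "fst ((one_pass ^^ q) (k', filter ((\<le>) k') xs)) = Suc n \<longleftrightarrow>
          card {j\<in>{k'..<n}. separated xs j} < q"
        by (rule less.hyps) (use k'(2) True less.prems in linarith)+
      then show ?thesis
        unfolding step card using Suc by simp
    next
      case False
      then have k'n: "k' = Suc n" using k'(3) by simp
      have "filter ((\<le>) k') xs = []" using assms(1) k'n by (auto simp: filter_empty_conv)
      moreover have "{j\<in>{k..<n}. separated xs j} = {}"
        using k'(5) unfolding k'n by auto
      ultimately show ?thesis
        unfolding step using k'n Suc by (simp only: funpow_one_pass_finished card.empty) simp
    qed
  qed
qed

text \<open>The final pass uses up no separated value, so it accounts for the one subtracted in
  \<open>tier\<close>.\<close>

lemma tier_eq_card_separated:
  assumes "\<sigma> \<in> permutations_of_set {1..n}" "1 \<le> n"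
  shows "tier \<sigma> = card {j\<in>{1..<n}. separated \<sigma> j}"
proof -
  have s: "set \<sigma> = {1..n}" "distinct \<sigma>" using assms(1) by (auto simp: permutations_of_set_def)
  have len: "length \<sigma> = n" using s distinct_card by fastforce
  have f: "filter ((\<le>) 1) \<sigma> = \<sigma>" using s(1) by (auto intro: filter_True)
  have "passes \<sigma> = (LEAST p. card {j\<in>{1..<n}. separated \<sigma> j} < p)"
    unfolding passes_def len using sorted_iff_separated_less[OF s, of 1] assms(2) f by simp
  also have "\<dots> = Suc (card {j\<in>{1..<n}. separated \<sigma> j})"
    by (rule Least_equality) auto
  finally show ?thesis by (simp add: tier_def)
qed

section \<open>Blocks and the upper bound\<close>

text \<open>
  In a block of separated values \<open>j = m, \<dots>, M - 1\<close> the entries \<open>M, \<dots>, m\<close> occur from left to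
  right, and the witnesses for their separation lie in disjoint gaps and exceed \<open>M\<close>.
\<close>

lemma separated_block_bound:
  assumes "set xs = {1..n}" "M \<le> n" "\<And>j. m \<le> j \<Longrightarrow> j < M \<Longrightarrow> separated xs j"
    and "distinct xs"
  shows "M - m \<le> n - M"
proof -
  have len: "length xs = n" using assms(1,4) distinct_card by fastforce
  have inj: "xs ! i = xs ! j \<longleftrightarrow> i = j" if "i < length xs" "j < length xs" for i j
    using assms(4) that by (rule nth_eq_iff_index_eq)
  have "\<forall>j\<in>{m..<M}. \<exists>a b c. a < b \<and> b < c \<and> c < n \<and> xs ! a = Suc j \<and> xs ! c = j \<and> Suc j < xs ! b"
    using assms(3) unfolding separated_def subseq3_iff_nth len by fastforce
  then obtain a b c where abc: "\<And>j. m \<le> j \<Longrightarrow> j < M \<Longrightarrow> a j < b j \<and> b j < c j \<and> c j < n \<and>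
      xs ! a j = Suc j \<and> xs ! c j = j \<and> Suc j < xs ! b j"
    unfolding Ball_def by (metis atLeastLessThan_iff)
  \<comment> \<open>Both positions carry the value \<open>Suc j\<close>, so consecutive patterns
    share an endpoint.\<close>
  have c_Suc: "c (Suc j) = a j" if "m \<le> j" "Suc j < M" for j
    using abc[of j] abc[of "Suc j"] that inj[of "c (Suc j)" "a j"] len by simp
  have dec: "c j \<le> a i" if "m \<le> i" "Suc i \<le> j" "j < M" for i j
    using that(2,3)
  proof (induction j rule: dec_induct)
    case base
    then show ?case using c_Suc[OF that(1)] by simp
  next
    case (step j)
    have "c (Suc j) = a j" "a j < c j" using c_Suc[of j] abc[of j] step that(1) by auto
    then show ?case using step by simp
  qed
  have b_less: "b j < b i" if "m \<le> i" "i < j" "j < M" for i j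
    using dec[of i j] abc[of i] abc[of j] that by fastforce
  have "inj_on (\<lambda>j. xs ! b j) {m..<M}"
  proof (rule linorder_inj_onI)
    fix i j assume ij: "i < j" "i \<in> {m..<M}" "j \<in> {m..<M}"
    then have "b j < b i" "b i < n" using b_less[of i j] abc[of i] by auto
    then show "xs ! b i \<noteq> xs ! b j" using inj[of "b i" "b j"] len by simp
  qed auto
  moreover have "(\<lambda>j. xs ! b j) ` {m..<M} \<subseteq> {Suc M..n}"
  proof (rule image_subsetI)
    fix j assume "j \<in> {m..<M}"
    then have j: "m \<le> j" "j < M" by auto
    have bn: "b j < n" using abc[OF j] by simp
    \<comment> \<open>Otherwise this witness is some \<open>Suc i\<close> with
      \<open>j < i < M\<close>, located at \<open>a i\<close>. But
      \<open>a i < b i < b j\<close>.\<close>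
    have "M < xs ! b j"
    proof (rule ccontr)
      assume "\<not> M < xs ! b j"
      then obtain i where i: "xs ! b j = Suc i" "j < i" "i < M"
        using abc[OF j] by (cases "xs ! b j") auto
      have "a i < b i" "b i < n" "xs ! a i = Suc i" using abc[of i] i j by auto
      then have "b j = a i" using i(1) inj[of "b j" "a i"] bn len by simp
      moreover have "b i < b j" using b_less[OF j(1) i(2,3)] .
      ultimately show False using \<open>a i < b i\<close> by simp
    qed
    moreover have "xs ! b j \<in> {1..n}" using bn nth_mem[of "b j" xs] assms(1) len by simp
    ultimately show "xs ! b j \<in> {Suc M..n}" by simp
  qed
  ultimately have "card {m..<M} \<le> card {Suc M..n}" by (rule card_inj_on_le) simp
  then show ?thesis by simp
qed

text \<open>Each unseparated value ends a block. If the first block is \<open>m, ..., M\<close>,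
  then \<open>M - m \<le> n - M\<close> gives \<open>n + 2 - m \<le> 2 * (n + 1 - M)\<close>, so
  each block contributes at most a factor 2.\<close>

lemma length_le_two_power_unseparated:
  assumes "set xs = {1..n}" "distinct xs" "1 \<le> m" "m \<le> Suc n"
  shows "n + 2 - m \<le> 2 ^ card {j\<in>{m..n}. \<not> separated xs j}"
  using assms(3,4)
proof (induction "Suc n - m" arbitrary: m rule: less_induct)
  case less
  show ?case
  proof (cases "m = Suc n")
    case True
    then show ?thesis by simp
  next
    case False
    \<comment> \<open>The last value \<open>n\<close> has no successor among the entries, so it ends
      a block.\<close>
    have "Suc n \<notin> set xs" using assms(1) by simp
    then have "\<not> separated xs n"
      unfolding separated_def subseq3_iff_nth by (metis nth_mem order.strict_trans)
    then have ex: "m \<le> n \<and> \<not> separated xs n" using False less.prems by simp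
    define M where "M = (LEAST M. m \<le> M \<and> \<not> separated xs M)"
    have M: "m \<le> M" "\<not> separated xs M" 
      using LeastI[of "\<lambda>M. m \<le> M \<and> \<not> separated xs M", OF ex] unfolding M_def by auto
    have Mn: "M \<le> n" unfolding M_def using ex by (rule Least_le)
    have sep: "separated xs j" if "m \<le> j" "j < M" for j
      using that not_less_Least[of j] unfolding M_def by blast
    have eq: "{j\<in>{m..n}. \<not> separated xs j} = insert M {j\<in>{Suc M..n}. \<not> separated xs j}"
    proof (intro equalityI subsetI)
      fix j assume j: "j \<in> {j\<in>{m..n}. \<not> separated xs j}"
      then have "\<not> j < M" using sep[of j] by auto
      then show "j \<in> insert M {j\<in>{Suc M..n}. \<not> separated xs j}" using j by auto
    next
      fix j assume "j \<in> insert M {j\<in>{Suc M..n}. \<not> separated xs j}"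
      then show "j \<in> {j\<in>{m..n}. \<not> separated xs j}" using M Mn by auto
    qed
    have card: "card {j\<in>{m..n}. \<not> separated xs j} = Suc (card {j\<in>{Suc M..n}. \<not> separated xs j})"
      unfolding eq by (rule card_insert_disjoint) auto
    have "n + 2 - Suc M \<le> 2 ^ card {j\<in>{Suc M..n}. \<not> separated xs j}"
      by (rule less.hyps) (use M(1) Mn in linarith)+
    moreover have "M - m \<le> n - M"
      using separated_block_bound[OF assms(1) Mn sep assms(2)] by blast
    ultimately show ?thesis unfolding card using M(1) Mn by simp
  qed
qed

text \<open>From \<open>2 ^ L < Suc n\<close> there are more than \<open>L\<close> blocks, and the
  last value of each block is lost to the count.\<close>

lemma tier_upper_bound:
  assumes "\<sigma> \<in> permutations_of_set {1..n}" "2 ^ L \<le> n"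
  shows "tier \<sigma> \<le> n - 1 - L"
proof -
  have s: "set \<sigma> = {1..n}" "distinct \<sigma>" using assms(1) by (auto simp: permutations_of_set_def)
  have n: "1 \<le> n" using assms(2) by (metis one_le_numeral one_le_power order_trans)
  let ?N = "{j\<in>{1..n}. \<not> separated \<sigma> j}" and ?S = "{j\<in>{1..<n}. separated \<sigma> j}"
  have "Suc n \<le> 2 ^ card ?N"
    using length_le_two_power_unseparated[OF s, of 1] by simp
  then have "(2::nat) ^ L < 2 ^ card ?N" using assms(2) by linarith
  then have "L < card ?N" by simp
  moreover have "card ?S + card ?N = card (?S \<union> ?N)"
    by (rule card_Un_disjoint[symmetric]) auto
  moreover have "card (?S \<union> ?N) \<le> card {1..n}" by (rule card_mono) auto
  ultimately show ?thesis unfolding tier_eq_card_separated[OF assms(1) n] by simp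
qed

section \<open>Interleaving and the lower bound\<close>

lemma subseq_splice: "subseq xs (splice xs ys)" "subseq ys (splice xs ys)"
  by (induction xs ys rule: splice.induct) (auto intro: list_emb_Cons)

lemma set_splice: "set (splice xs ys) = set xs \<union> set ys"
  by (induction xs ys rule: splice.induct) auto

lemma distinct_splice:
  "distinct (splice xs ys) \<longleftrightarrow> distinct xs \<and> distinct ys \<and> set xs \<inter> set ys = {}"
  by (induction xs ys rule: splice.induct) (auto simp: set_splice)

text \<open>\<open>splice\<close> alternates, starting with \<open>xs\<close>, and \<open>ys\<close>
  is long enough to fill every gap of \<open>xs\<close>.\<close>

lemma subseq_splice_consecutive:
  assumes "Suc i < length xs" "length xs \<le> Suc (length ys)"
  shows "\<exists>y\<in>set ys. subseq [xs ! i, y, xs ! Suc i] (splice xs ys)"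
  using assms
proof (induction xs arbitrary: i ys)
  case (Cons x xs)
  then obtain y ys' where ys: "ys = y # ys'" by (cases ys) auto
  from Cons.prems obtain x' xs' where xs: "xs = x' # xs'" by (cases xs) auto
  show ?case
  proof (cases i)
    case 0
    then show ?thesis using xs ys by auto
  next
    case (Suc i')
    have "Suc i' < length xs" "length xs \<le> Suc (length ys')" using Cons.prems Suc ys by auto
    from Cons.IH[OF this] obtain z where
      z: "z \<in> set ys'" "subseq [xs ! i', z, xs ! Suc i'] (splice xs ys')" by blast
    have "subseq [xs ! i', z, xs ! Suc i'] (splice (x # xs) ys)"
      using z(2) unfolding ys splice.simps by (intro list_emb_Cons)
    then show ?thesis using z(1) unfolding Suc nth_Cons_Suc ys list.set by blast
  qed
qed simp

lemma separated_map_add: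
  assumes "separated xs k"
  shows "separated (map ((+) s) xs) (s + k)"
proof -
  obtain c where c: "c > Suc k" "subseq [Suc k, c, k] xs" using assms unfolding separated_def by blast
  from subseq_map[OF c(2), of "(+) s"] show ?thesis
    unfolding separated_def using c(1) by (intro exI[of _ "s + c"]) simp
qed

text \<open>Interleave \<open>s, ..., 1\<close> with \<open>\<rho>\<close> shifted up by
  \<open>s\<close>. Larger entries in the gaps separate \<open>1, ..., s - 1\<close>, and the
  shifted copy keeps its own separations.\<close>

lemma tier_lower_bound:
  assumes "\<rho> \<in> permutations_of_set {1..m}" "1 \<le> m" "1 \<le> s" "s \<le> Suc m"
  obtains \<sigma> where "\<sigma> \<in> permutations_of_set {1..s + m}" "tier \<sigma> \<ge> s - 1 + tier \<rho>"
proof -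
  let ?xs = "rev [1..<Suc s]" and ?ys = "map ((+) s) \<rho>"
  define \<sigma> where "\<sigma> = splice ?xs ?ys"
  have \<rho>: "set \<rho> = {1..m}" "distinct \<rho>" using assms(1) by (auto simp: permutations_of_set_def)
  have len: "length \<rho> = m" using \<rho> distinct_card by fastforce
  have ys: "set ?ys = {Suc s..s + m}"
    unfolding set_map \<rho>(1) image_add_atLeastAtMost by simp
  have "set \<sigma> = {1..s + m}" unfolding \<sigma>_def set_splice ys by auto
  moreover have "distinct \<sigma>"
    unfolding \<sigma>_def distinct_splice ys using \<rho>(2) by (auto simp: distinct_map)
  ultimately have \<sigma>: "\<sigma> \<in> permutations_of_set {1..s + m}" by (auto simp: permutations_of_set_def)
  have low: "separated \<sigma> j" if "1 \<le> j" "j < s" for j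
  proof -
    \<comment> \<open>In the decreasing list, position \<open>s - Suc j\<close> holds
      \<open>Suc j\<close>, and the next position holds \<open>j\<close>.\<close>
    have "Suc (s - Suc j) < length ?xs" "length ?xs \<le> Suc (length ?ys)"
      using that assms(4) len by auto
    from subseq_splice_consecutive[OF this] obtain y where
      y: "y \<in> set ?ys" "subseq [?xs ! (s - Suc j), y, ?xs ! Suc (s - Suc j)] \<sigma>"
      unfolding \<sigma>_def by blast
    have "?xs ! (s - Suc j) = Suc j" "?xs ! Suc (s - Suc j) = j"
      using that by (auto simp: rev_nth nth_append simp del: upt_Suc)
    moreover have "y > Suc j" using y(1) that unfolding ys by simp
    ultimately show ?thesis using y(2) unfolding separated_def by auto
  qed
  have high: "separated \<sigma> (s + k)" if "separated \<rho> k" for k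
    using separated_map_add[OF that, of s] subseq_splice(2)[of ?ys ?xs]
    unfolding separated_def \<sigma>_def by (blast intro: subseq_order.trans)
  let ?S = "{k\<in>{1..<m}. separated \<rho> k}"
  have "card ({1..<s} \<union> (+) s ` ?S) = card {1..<s} + card ((+) s ` ?S)"
    by (rule card_Un_disjoint) auto
  then have "s - 1 + tier \<rho> = card ({1..<s} \<union> (+) s ` ?S)"
    unfolding tier_eq_card_separated[OF assms(1,2)] by (simp add: card_image)
  also have "\<dots> \<le> card {k\<in>{1..<s + m}. separated \<sigma> k}"
    using low high assms(2,3) by (intro card_mono) auto
  also have "\<dots> = tier \<sigma>" using tier_eq_card_separated[OF \<sigma>] assms(2) by simp
  finally show thesis using \<sigma> that by blast
qed

section \<open>The closed form of the maximum\<close>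

lemma tier_le_tau: "\<sigma> \<in> permutations_of_set {1..n} \<Longrightarrow> tier \<sigma> \<le> tau n"
  unfolding tau_def by (intro Max_ge) auto

lemma tau_attained:
  obtains \<sigma> where "\<sigma> \<in> permutations_of_set {1..n}" "tier \<sigma> = tau n"
proof -
  have "tau n \<in> tier ` permutations_of_set {1..n}"
    unfolding tau_def by (intro Max_in) auto
  then show thesis using that by auto
qed

text \<open>\<open>s = n - n div 2\<close> is the largest block length whose gaps the other
  \<open>n - s\<close> values can fill.\<close>

lemma tau_lower_bound:
  assumes "n \<ge> 2"
  shows "(n - 1) div 2 + tau (n div 2) \<le> tau n"
proof -
  obtain \<rho> where \<rho>: "\<rho> \<in> permutations_of_set {1..n div 2}" "tier \<rho> = tau (n div 2)"
    by (rule tau_attained)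
  obtain \<sigma> where \<sigma>: "\<sigma> \<in> permutations_of_set {1..n - n div 2 + n div 2}"
    "tier \<sigma> \<ge> n - n div 2 - 1 + tier \<rho>"
    by (rule tier_lower_bound[OF \<rho>(1), of "n - n div 2"]) (use assms in auto)
  have "n - n div 2 - 1 = (n - 1) div 2" "n - n div 2 + n div 2 = n" using assms by auto
  then show ?thesis using \<sigma> \<rho>(2) tier_le_tau[of \<sigma> n] by simp
qed

text \<open>\<open>L\<close> is the integer part of the binary logarithm. Halving \<open>n\<close>
  lowers it by one, which drives the induction for the lower bound.\<close>

lemma tau_closed_form:
  assumes "2 ^ L \<le> n" "n < 2 ^ Suc L"
  shows "tau n = n - 1 - L"
proof (rule antisym)
  show "tau n \<le> n - 1 - L"
    using tau_attained[of n] tier_upper_bound[OF _ assms(1)] by metis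
  show "n - 1 - L \<le> tau n"
    using assms
  proof (induction L arbitrary: n)
    case 0
    then show ?case by simp
  next
    case (Suc L)
    have "2 ^ L \<le> n div 2" "n div 2 < 2 ^ Suc L" using Suc.prems by auto
    from Suc.IH[OF this] have IH: "n div 2 - 1 - L \<le> tau (n div 2)" .
    have "1 \<le> (2::nat) ^ L" by simp
    then have "2 \<le> n" using Suc.prems(1) unfolding power_Suc by linarith
    \<comment> \<open>Uses \<open>(n - 1) div 2 + n div 2 = n - 1\<close>.\<close>
    from tau_lower_bound[OF this] IH show ?case by linarith
  qed
qed

section \<open>The sum of floors\<close>

text \<open>With \<open>a = n div 2 ^ i\<close>, both sides are half of \<open>a\<close>, rounded
  up, minus 1. The right side makes the sum telescope.\<close>

lemma floor_term_telescopes: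
  fixes n i :: nat
  shows "\<lfloor>(real n - 2 ^ i) / 2 ^ Suc i\<rfloor> = int (n div 2 ^ i) - int (n div 2 ^ Suc i) - 1"
proof -
  define a r where "a = n div 2 ^ i" and "r = n mod 2 ^ i"
  define b e where "b = a div 2" and "e = a mod 2"
  have "n = 2 ^ i * a + r" unfolding a_def r_def by simp
  then have n: "real n = 2 ^ i * real a + real r" by simp
  have "real r < real (2 ^ i)" unfolding r_def of_nat_less_iff by simp
  then have r: "real r < 2 ^ i" by simp
  then have r2: "real r < 2 * 2 ^ i" using zero_le_power[of "2::real" i] by linarith
  have b: "n div 2 ^ Suc i = b" unfolding b_def a_def power_Suc2 by (rule div_mult2_eq)
  have a: "a = 2 * b + e" unfolding b_def e_def by simp
  consider "e = 0" | "e = 1" unfolding e_def by linarith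
  \<comment> \<open>The quotient is \<open>b + (e - 1) / 2\<close> plus a remainder part in
    \<open>[0, 1/2)\<close>, so each parity \<open>e\<close> fixes its floor.\<close>
  then have "int b + int e - 1 \<le> (real n - 2 ^ i) / 2 ^ Suc i \<and>
      (real n - 2 ^ i) / 2 ^ Suc i < int b + int e - 1 + 1"
    by cases (use r r2 in \<open>simp_all add: n a field_simps\<close>)
  then have "\<lfloor>(real n - 2 ^ i) / 2 ^ Suc i\<rfloor> = int b + int e - 1"
    by (intro floor_unique) simp_all
  then show ?thesis unfolding b unfolding a_def[symmetric] a by simp
qed

lemma sum_floor_terms:
  fixes n L :: nat
  assumes "2 ^ L \<le> n" "n < 2 ^ Suc L"
  shows "(\<Sum>j | 1 \<le> j \<and> 2 ^ (j - 1) \<le> n. \<lfloor>(real n - 2 ^ (j - 1)) / 2 ^ j\<rfloor>) = int n - 1 - int L"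
proof -
  \<comment> \<open>The nonnegative terms are those with \<open>j = 1, ..., L + 1\<close>.\<close>
  have "(1 \<le> j \<and> 2 ^ (j - 1) \<le> n) \<longleftrightarrow> j \<in> Suc ` {..L}" for j
  proof (cases j)
    case (Suc i)
    have "2 ^ i \<le> n \<longleftrightarrow> i \<le> L"
    proof
      assume "2 ^ i \<le> n"
      then have "(2::nat) ^ i < 2 ^ Suc L" using assms(2) by (rule le_less_trans)
      then show "i \<le> L" by (simp del: power_Suc)
    next
      assume "i \<le> L"
      then have "(2::nat) ^ i \<le> 2 ^ L" by simp
      then show "2 ^ i \<le> n" using assms(1) by (rule order_trans)
    qed
    then show ?thesis using Suc by auto
  qed auto
  then have "{j. 1 \<le> j \<and> 2 ^ (j - 1) \<le> n} = Suc ` {..L}" by blast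
  then have "(\<Sum>j | 1 \<le> j \<and> 2 ^ (j - 1) \<le> n. \<lfloor>(real n - 2 ^ (j - 1)) / 2 ^ j\<rfloor>)
      = (\<Sum>i\<le>L. \<lfloor>(real n - 2 ^ i) / 2 ^ Suc i\<rfloor>)"
    by (simp add: sum.reindex)
  also have "\<dots> = (\<Sum>i\<le>L. int (n div 2 ^ i) - int (n div 2 ^ Suc i)) - int (Suc L)"
    unfolding floor_term_telescopes by (simp add: sum_subtractf)
  also have "\<dots> = int n - int (n div 2 ^ Suc L) - int (Suc L)"
    using sum_telescope[of "\<lambda>i. int (n div 2 ^ i)" L] by simp
  also have "n div 2 ^ Suc L = 0" using assms(2) by (rule div_less)
  finally show ?thesis by simp
qed

theorem theorem3p12:
  shows "(\<forall>n::nat. n \<ge> 2 \<longrightarrow> tau n = (n - 1) div 2 + tau (n div 2)) \<and>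
    (\<forall>n::nat. n \<ge> 1 \<longrightarrow>
      int (tau n) = (\<Sum>j | 1 \<le> j \<and> 2 ^ (j - 1) \<le> n. \<lfloor>(real n - 2 ^ (j - 1)) / 2 ^ j\<rfloor>) \<and>
      (\<Sum>j | 1 \<le> j \<and> 2 ^ (j - 1) \<le> n. \<lfloor>(real n - 2 ^ (j - 1)) / 2 ^ j\<rfloor>)
        = int n - 1 - \<lfloor>log 2 (real n)\<rfloor>)"
proof (intro conjI allI impI)
  fix n :: nat assume n: "n \<ge> 1"
  then obtain L where L: "2 ^ L \<le> n" "n < 2 ^ Suc L"
    using ex_power_ivl1[of 2 n] by auto
  \<comment> \<open>Ensures that \<open>n - 1 - L\<close> is not truncated.\<close>
  have "L < n" using L(1) less_exp[of L] by linarith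
  then show "int (tau n) = (\<Sum>j | 1 \<le> j \<and> 2 ^ (j - 1) \<le> n. \<lfloor>(real n - 2 ^ (j - 1)) / 2 ^ j\<rfloor>)"
    unfolding sum_floor_terms[OF L] tau_closed_form[OF L] by simp
  have "\<lfloor>log 2 (real n)\<rfloor> = int L"
    using floor_log_nat_eq_if[of 2 L n] L by simp
  then show "(\<Sum>j | 1 \<le> j \<and> 2 ^ (j - 1) \<le> n. \<lfloor>(real n - 2 ^ (j - 1)) / 2 ^ j\<rfloor>)
      = int n - 1 - \<lfloor>log 2 (real n)\<rfloor>"
    unfolding sum_floor_terms[OF L] by simp
next
  fix n :: nat assume n: "n \<ge> 2"
  \<comment> \<open>The recursion compares the closed forms at \<open>n div 2\<close> and
    \<open>n\<close>, with exponents \<open>L\<close> and \<open>Suc L\<close>.\<close>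
  obtain L where L: "2 ^ L \<le> n div 2" "n div 2 < 2 ^ Suc L"
    using ex_power_ivl1[of 2 "n div 2"] div_le_mono[OF n, of 2] by auto
  have "L < n div 2" using L(1) less_exp[of L] by linarith
  moreover have "2 ^ Suc L \<le> n" "n < 2 ^ Suc (Suc L)" using L by auto
  ultimately show "tau n = (n - 1) div 2 + tau (n div 2)"
    unfolding tau_closed_form[OF L] using tau_closed_form[of "Suc L" n] by linarith
qed

end
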